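(* Let $G$ be a connected graph of order $n$ with chromatic number $r$, where $3 \leq r \leq n-1$. Write $n = rd + s$ with integers $d$ and $0 \le s < r$. If $0 \le \alpha \le 1 - \frac{1}{r}$, then $$\rho_{D_\alpha}(G) \ge \rho_{D_\alpha}(T_{n,r}) = \frac{n + 2d + \alpha n - 3 + \sqrt{(n(1-\alpha) - 1)^2 + 4s(1-\alpha)(d+1)}}{2},$$ and equality holds if and only if $G \cong T_{n,r}$.
   Context: All graphs are finite, simple and connected. For a connected graph $G$ with vertex set $V(G)$, $d_{uv}$ denotes the distance (length of a shortest path) between vertices $u,v$, and the transmission of $u$ is $Tr(u)=\sum_{v\in V(G)} d_{uv}$. $D(G)=(d_{uv})$ is the distance matrix, $Tr(G)$ is the diagonal matrix of vertex transmissions, and the generalized distance matrix is $D_\alpha(G) = \alpha\, Tr(G) + (1-\alpha) D(G)$ for $0 \le \alpha \le 1$. $\rho_{D_\alpha}(G)$ denotes the spectral radius (largest eigenvalue) of $D_\alpha(G)$. The chromatic number of $G$ is the smallest number of colors in a proper vertex coloring. $T_{n,r}$ is the Turán graph: the complete $r$-partite graph on $n$ vertices whose part sizes differ by at most one (so it has $s$ parts of size $d+1$ and $r-s$ parts of size $d$). *)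

theory Defs
  imports
    "Graph_Theory.Graph_Theory"
    "Jordan_Normal_Form.Spectral_Radius"
begin

text \<open>
  A finite simple graph is a \<open>pair_graph\<close>: an irreflexive symmetric arc relation on a finite vertex
  set, each undirected edge being represented by its two orientations. The length of an
  \<open>awalk\<close> therefore counts undirected edges.
\<close>

text \<open>\<open>wf_digraph.\<mu>\<close> is the infimum, in the extended reals, of the costs of all walks from
  \<open>u\<close> to \<open>v\<close>; \<open>vdist_eq_shortest_path\<close> below confirms the reading as a shortest path length.\<close>

definition vdist :: "'a pair_pre_digraph \<Rightarrow> 'a \<Rightarrow> 'a \<Rightarrow> real" where
  "vdist G u v = real_of_ereal (wf_digraph.\<mu> (with_proj G) (\<lambda>_. 1) u v)"

definition transmission :: "'a pair_pre_digraph \<Rightarrow> 'a \<Rightarrow> real" where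
  "transmission G u = (\<Sum>v\<in>pverts G. vdist G u v)"

text \<open>Matrices are indexed by \<open>{0..<n}\<close>, so the vertices have to be put in some order. Another
  order conjugates the matrices below by a permutation matrix and leaves spectra unchanged.\<close>

definition vertex_list :: "'a pair_pre_digraph \<Rightarrow> 'a list" where
  "vertex_list G = (SOME vs. distinct vs \<and> set vs = pverts G)"

definition distance_mat :: "'a pair_pre_digraph \<Rightarrow> real mat" where
  "distance_mat G = (let n = card (pverts G); vs = vertex_list G in
     mat n n (\<lambda>(i, j). vdist G (vs ! i) (vs ! j)))"

definition transmission_mat :: "'a pair_pre_digraph \<Rightarrow> real mat" where
  "transmission_mat G = (let n = card (pverts G); vs = vertex_list G in
     mat_diag n (\<lambda>i. transmission G (vs ! i)))"

definition gen_distance_mat :: "real \<Rightarrow> 'a pair_pre_digraph \<Rightarrow> real mat" where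
  "gen_distance_mat \<alpha> G = \<alpha> \<cdot>\<^sub>m transmission_mat G + (1 - \<alpha>) \<cdot>\<^sub>m distance_mat G"

text \<open>\<open>spectral_radius\<close> is the largest modulus of a complex eigenvalue. For \<open>0 \<le> \<alpha> \<le> 1\<close> the matrix is
  nonnegative and symmetric, so by Perron--Frobenius this is its largest eigenvalue.\<close>

definition gen_distance_radius :: "real \<Rightarrow> 'a pair_pre_digraph \<Rightarrow> real" where
  "gen_distance_radius \<alpha> G = spectral_radius (map_mat complex_of_real (gen_distance_mat \<alpha> G))"

definition proper_coloring :: "'a pair_pre_digraph \<Rightarrow> nat \<Rightarrow> ('a \<Rightarrow> nat) \<Rightarrow> bool" where
  "proper_coloring G k c \<longleftrightarrow>
     (\<forall>v\<in>pverts G. c v < k) \<and> (\<forall>u v. (u, v) \<in> parcs G \<longrightarrow> c u \<noteq> c v)"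

definition chromatic_number :: "'a pair_pre_digraph \<Rightarrow> nat" where
  "chromatic_number G = (LEAST k. \<exists>c. proper_coloring G k c)"

text \<open>The parts of the Turan graph are the residue classes modulo \<open>r\<close> in \<open>{0..<n}\<close>; their sizes
  are given by \<open>card_turan_part\<close>.\<close>

definition turan_graph :: "nat \<Rightarrow> nat \<Rightarrow> nat pair_pre_digraph" where
  "turan_graph n r = \<lparr> pverts = {0..<n},
     parcs = {(i, j). i \<in> {0..<n} \<and> j \<in> {0..<n} \<and> i mod r \<noteq> j mod r} \<rparr>"

lemma vertex_list:
  assumes "pair_graph G"
  shows "distinct (vertex_list G)" "set (vertex_list G) = pverts G"
proof -
  interpret pair_graph G by fact
  have "\<exists>vs. distinct vs \<and> set vs = pverts G"
    using finite_distinct_list[OF pair_finite_verts] by blast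
  then have "distinct (vertex_list G) \<and> set (vertex_list G) = pverts G"
    unfolding vertex_list_def by (rule someI_ex)
  then show "distinct (vertex_list G)" "set (vertex_list G) = pverts G" by auto
qed

lemma vdist_eq_shortest_path:
  assumes "pair_graph G" "Digraph_Component.connected (with_proj G)" "u \<in> pverts G" "v \<in> pverts G"
  shows "vdist G u v =
    real (LEAST k. \<exists>p. pre_digraph.apath (with_proj G) u p v \<and> length p = k)"
proof -
  interpret pair_graph G by fact
  let ?P = "\<lambda>k. \<exists>p. apath u p v \<and> length p = k"
  define k where "k = (LEAST k. ?P k)"
  have cost: "awalk_cost (\<lambda>_. 1) p = real (length p)" for p :: "('a \<times> 'a) list"
    by (induction p) simp_all
  have "strongly_connected (with_proj G)"
    using symmetric_connected_imp_strongly_connected sym_arcs assms(2) by blast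
  then have "u \<rightarrow>\<^sup>*\<^bsub>G\<^esub> v"
    using assms(3,4) by (auto simp: strongly_connected_def)
  then obtain p0 where "apath u p0 v"
    using reachable_apath by auto
  then have "?P (length p0)" by blast
  then have "?P k" unfolding k_def by (rule LeastI)
  then obtain p where p: "apath u p v" "length p = k" by blast
  have "\<mu> (\<lambda>_. 1) u v = ereal (real k)"
    unfolding \<mu>_def
  proof (rule INF_eqI)
    fix q assume "q \<in> {q. awalk u q v}"
    then have q: "awalk u q v" by simp
    obtain q' where q': "apath u q' v" "length q' \<le> length q"
    proof
      show "apath u (awalk_to_apath q) v" using q by (rule apath_awalk_to_apath)
      show "length (awalk_to_apath q) \<le> length q"
      proof -
        have "distinct (awalk_to_apath q)"
          using apath_awalk_to_apath[OF q] by (auto simp: apath_def intro: distinct_verts_imp_distinct)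
        then have "length (awalk_to_apath q) = card (set (awalk_to_apath q))"
          by (simp add: distinct_card)
        also have "\<dots> \<le> card (set q)"
          using awalk_to_apath_subset[OF q] by (intro card_mono) auto
        also have "\<dots> \<le> length q" by (rule card_length)
        finally show ?thesis .
      qed
    qed
    have "k \<le> length q'" unfolding k_def by (rule Least_le) (use q' in blast)
    then show "ereal (real k) \<le> ereal (awalk_cost (\<lambda>_. 1) q)"
      using q' by (simp add: cost)
  next
    fix y assume "\<And>q. q \<in> {q. awalk u q v} \<Longrightarrow> y \<le> ereal (awalk_cost (\<lambda>_. 1) q)"
    from this[of p] show "y \<le> ereal (real k)" using p by (simp add: cost apath_def)
  qed
  then show ?thesis unfolding vdist_def k_def by simp
qed

lemma pair_graph_turan_graph: "pair_graph (turan_graph n r)"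
proof
  show "finite (parcs (turan_graph n r))"
    by (rule finite_subset[of _ "{0..<n} \<times> {0..<n}"]) (auto simp: turan_graph_def)
qed (auto simp: turan_graph_def symmetric_def intro: symI)

lemma card_turan_part:
  assumes "k < r"
  shows "card {i \<in> pverts (turan_graph n r). i mod r = k} =
    n div r + (if k < n mod r then 1 else 0)"
proof -
  define q where "q = n div r + (if k < n mod r then 1 else 0)"
  have bound: "k + j * r < n \<longleftrightarrow> j < q" for j
  proof -
    have n: "n = n div r * r + n mod r" and t: "n mod r < r" using assms by simp_all
    have "k + j * r < n" if "j < n div r"
    proof -
      have "Suc j * r \<le> n div r * r" using that by (intro mult_right_mono) auto
      then show ?thesis using n assms unfolding mult_Suc by linarith
    qed
    moreover have "\<not> k + j * r < n" if "j > n div r"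
    proof -
      have "Suc (n div r) * r \<le> j * r" using that by (intro mult_right_mono) auto
      then show ?thesis using n t unfolding mult_Suc by linarith
    qed
    moreover have "k + j * r < n \<longleftrightarrow> k < n mod r" if "j = n div r"
      unfolding that using n by linarith
    ultimately show ?thesis
      unfolding q_def by (cases j "n div r" rule: linorder_cases) auto
  qed
  have "{i \<in> pverts (turan_graph n r). i mod r = k} = (\<lambda>j. k + j * r) ` {..<q}"
  proof (intro equalityI subsetI)
    fix i assume "i \<in> {i \<in> pverts (turan_graph n r). i mod r = k}"
    then have "i < n" "i mod r = k" by (simp_all add: turan_graph_def)
    then have i: "i < n" "i = k + i div r * r" using mod_div_mult_eq[of i r] by simp_all
    then have "k + i div r * r < n" by argo
    then have "i div r \<in> {..<q}" unfolding bound by simp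
    with i(2) show "i \<in> (\<lambda>j. k + j * r) ` {..<q}" by (rule image_eqI)
  next
    fix i assume "i \<in> (\<lambda>j. k + j * r) ` {..<q}"
    then obtain j where j: "i = k + j * r" "j < q" by blast
    have "i < n" unfolding j(1) bound by (rule j(2))
    moreover have "i mod r = k" unfolding j(1) using assms by simp
    ultimately show "i \<in> {i \<in> pverts (turan_graph n r). i mod r = k}"
      by (simp add: turan_graph_def)
  qed
  moreover have "inj_on (\<lambda>j. k + j * r) {..<q}" using assms by (auto simp: inj_on_def)
  ultimately show ?thesis by (simp add: card_image q_def)
qed

end

theory Submission
  imports Defs
begin

text \<open>
  Fix a proper colouring with \<open>r\<close> colours and part sizes \<open>m\<^sub>k\<close>. Distances in \<open>G\<close> dominate those of
  the complete multipartite graph on these parts, so for a positive vector \<open>x\<close> constant on parts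
  \<open>D\<^sub>\<alpha>(G) x \<ge> \<rho> x\<close> follows from \<open>(t - m\<^sub>k) x\<^sub>k \<le> (1 - \<alpha>) (\<Sum>j. m\<^sub>j x\<^sub>j)\<close>, where \<open>\<rho> = t + \<alpha> n - 2\<close>.
  For the radius \<open>\<rho>\<close> of the Turan graph and parts smaller than \<open>t\<close> the choice \<open>x\<^sub>k = 1 / (t - m\<^sub>k)\<close> works, because
  \<open>(1 - \<alpha>) (\<Sum>j. m\<^sub>j / (t - m\<^sub>j))\<close> is convex in the integers \<open>m\<^sub>j\<close> and equals \<open>1\<close> for
  balanced parts. A positive vector with \<open>A x \<ge> \<rho> x\<close> bounds the spectral radius of a nonnegative
  \<open>A\<close> from below, strictly so if one coordinate is strict and all off-diagonal entries are positive.
\<close>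

section \<open>Spectral radius of nonnegative matrices\<close>

lemma index_mult_mat_vec_sum:
  assumes "A \<in> carrier_mat n n" "x \<in> carrier_vec n" "i < n"
  shows "(A *\<^sub>v x) $ i = (\<Sum>j<n. A $$ (i, j) * x $ j)"
  using assms by (simp add: scalar_prod_def atLeast0LessThan)

lemma smult_mat_mult_vec:
  fixes A :: "'a :: comm_semiring_0 mat"
  assumes "A \<in> carrier_mat n m" "x \<in> carrier_vec m"
  shows "(k \<cdot>\<^sub>m A) *\<^sub>v x = k \<cdot>\<^sub>v (A *\<^sub>v x)"
  using assms by (intro eq_vecI) (auto simp: scalar_prod_def sum_distrib_left mult_ac)

lemma mult_mat_vec_mono:
  fixes A :: "real mat"
  assumes A: "A \<in> carrier_mat n n" "\<And>i j. i < n \<Longrightarrow> j < n \<Longrightarrow> A $$ (i, j) \<ge> 0"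
    and x: "x \<in> carrier_vec n" and y: "y \<in> carrier_vec n" "\<And>j. j < n \<Longrightarrow> x $ j \<le> y $ j" and i: "i < n"
  shows "(A *\<^sub>v x) $ i \<le> (A *\<^sub>v y) $ i"
  unfolding index_mult_mat_vec_sum[OF A(1) x i] index_mult_mat_vec_sum[OF A(1) y(1) i]
  by (intro sum_mono mult_left_mono) (use assms in auto)

lemma eigenvalue_norm_le_spectral_radius:
  assumes A: "A \<in> carrier_mat n n" and e: "eigenvalue A e"
  shows "norm e \<le> spectral_radius A"
  using spectral_radius_mem_max(2)[OF A eigenvalue_imp_nonzero_dim[OF A e]] e
  by (auto simp: spectrum_def)

lemma spectral_radius_attained:
  assumes A: "A \<in> carrier_mat n n" and "n > 0"
  obtains e v where "v \<in> carrier_vec n" "v \<noteq> 0\<^sub>v n" "A *\<^sub>v v = e \<cdot>\<^sub>v v" "norm e = spectral_radius A"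
proof -
  obtain e where "e \<in> spectrum A" "norm e = spectral_radius A"
    using spectral_radius_mem_max(1)[OF assms] by force
  then show thesis
    using that A unfolding spectrum_def eigenvalue_def eigenvector_def by auto
qed

text \<open>For the upper bound, any complex eigenvector is compared with \<open>x\<close> at the
  coordinate where its modulus relative to \<open>x\<close> is largest. For the lower bound,
  \<open>l\<close> is itself an eigenvalue.\<close>

lemma spectral_radius_eq_positive_eigenvector:
  fixes A :: "real mat"
  assumes A: "A \<in> carrier_mat n n" "\<And>i j. i < n \<Longrightarrow> j < n \<Longrightarrow> A $$ (i, j) \<ge> 0" and n: "n > 0"
    and x: "x \<in> carrier_vec n" "\<And>i. i < n \<Longrightarrow> x $ i > 0" and eig: "A *\<^sub>v x = l \<cdot>\<^sub>v x"
  shows "spectral_radius (map_mat complex_of_real A) = l"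
proof (rule antisym)
  let ?A = "map_mat complex_of_real A"
  have A': "?A \<in> carrier_mat n n" using A(1) by simp
  have eigi: "(\<Sum>j<n. A $$ (i, j) * x $ j) = l * x $ i" if "i < n" for i
    using arg_cong[OF eig, of "\<lambda>v. v $ i"] index_mult_mat_vec_sum[OF A(1) x(1) that] x(1) that by simp
  obtain e v where v: "v \<in> carrier_vec n" "v \<noteq> 0\<^sub>v n" "?A *\<^sub>v v = e \<cdot>\<^sub>v v"
    and e: "norm e = spectral_radius ?A"
    using spectral_radius_attained[OF A' n] .
  define q where "q i = norm (v $ i) / x $ i" for i
  obtain i where i: "i < n" "\<And>j. j < n \<Longrightarrow> q j \<le> q i"
  proof -
    have "finite (q ` {..<n})" "q ` {..<n} \<noteq> {}" using n by auto
    from Max_in[OF this] obtain i where "i < n" "q i = Max (q ` {..<n})" by auto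
    then show thesis using that by auto
  qed
  obtain j where j: "j < n" "v $ j \<noteq> 0" using v(1,2) by (metis eq_vecI carrier_vecD index_zero_vec)
  have "0 < q j" using j x(2) by (simp add: q_def)
  then have qpos: "0 < q i" using i(2)[OF j(1)] by simp
  have vj: "norm (v $ j) \<le> q i * x $ j" if "j < n" for j
    using i(2)[OF that] x(2)[OF that] by (simp add: q_def divide_simps split: if_splits)
  have "norm e * (q i * x $ i) = norm (e * v $ i)"
    using x(2)[OF i(1)] by (simp add: q_def norm_mult)
  also have "e * v $ i = (\<Sum>j<n. ?A $$ (i, j) * v $ j)"
    using arg_cong[OF v(3), of "\<lambda>v. v $ i"] index_mult_mat_vec_sum[OF A' v(1) i(1)] v(1) i(1) by simp
  also have "norm \<dots> \<le> (\<Sum>j<n. A $$ (i, j) * (q i * x $ j))"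
    by (rule sum_norm_le) (use vj A i in \<open>auto simp: norm_mult intro: mult_left_mono\<close>)
  also have "\<dots> = q i * (\<Sum>j<n. A $$ (i, j) * x $ j)"
    by (simp add: sum_distrib_left mult_ac)
  also have "\<dots> = l * (q i * x $ i)" using eigi[OF i(1)] by simp
  finally show "spectral_radius ?A \<le> l" using qpos x(2)[OF i(1)] by (simp add: e)
  have "eigenvector ?A (map_vec complex_of_real x) (complex_of_real l)"
    unfolding eigenvector_def
  proof (intro conjI)
    show "map_vec complex_of_real x \<in> carrier_vec (dim_row ?A)" using A(1) x(1) by simp
    have "map_vec complex_of_real x $ 0 \<noteq> 0\<^sub>v (dim_row ?A) $ 0"
      using x n A(1) by (metis carrier_matD(1) carrier_vecD index_map_mat(2) index_map_vec(1) index_zero_vec(1)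
          less_numeral_extra(3) of_real_eq_0_iff)
    then show "map_vec complex_of_real x \<noteq> 0\<^sub>v (dim_row ?A)" by metis
    show "?A *\<^sub>v map_vec complex_of_real x = complex_of_real l \<cdot>\<^sub>v map_vec complex_of_real x"
      using of_real_hom.mult_mat_vec_hom[OF A(1) x(1)] eig of_real_hom.vec_hom_smult by metis
  qed
  then have "eigenvalue ?A (complex_of_real l)" unfolding eigenvalue_def by blast
  from eigenvalue_norm_le_spectral_radius[OF A' this]
  show "l \<le> spectral_radius ?A" by simp
qed

text \<open>Nonnegative matrices preserve coordinatewise inequalities, so the hypothesis on
  \<open>A\<close> can be iterated.\<close>

lemma pow_mat_mult_vec_ge:
  fixes A :: "real mat"
  assumes A: "A \<in> carrier_mat n n" "\<And>i j. i < n \<Longrightarrow> j < n \<Longrightarrow> A $$ (i, j) \<ge> 0"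
    and x: "x \<in> carrier_vec n" and ge: "\<And>i. i < n \<Longrightarrow> l * x $ i \<le> (A *\<^sub>v x) $ i" and l: "0 \<le> l"
    and i: "i < n"
  shows "l ^ k * x $ i \<le> (A ^\<^sub>m k *\<^sub>v x) $ i"
proof -
  have "\<forall>i<n. l ^ k * x $ i \<le> (A ^\<^sub>m k *\<^sub>v x) $ i"
  proof (induction k)
    case 0
    then show ?case using x A(1) by simp
  next
    case (Suc k)
    have Ak: "A ^\<^sub>m k \<in> carrier_mat n n" using A(1) by simp
    have nonneg: "(A ^\<^sub>m k) $$ (i, j) \<ge> 0" if "i < n" "j < n" for i j
      using that
    proof (induction k arbitrary: i j)
      case 0
      then show ?case using A(1) by simp
    next
      case (Suc k)
      then show ?case using A pow_carrier_mat[OF A(1), of k]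
        by (auto simp: scalar_prod_def intro!: sum_nonneg)
    qed
    show ?case
    proof (intro allI impI)
      fix i assume i: "i < n"
      have "l ^ Suc k * x $ i = l * (l ^ k * x $ i)" by simp
      also have "\<dots> \<le> l * (A ^\<^sub>m k *\<^sub>v x) $ i" using Suc i l by (intro mult_left_mono) auto
      also have "\<dots> = (A ^\<^sub>m k *\<^sub>v (l \<cdot>\<^sub>v x)) $ i"
        using mult_mat_vec[OF Ak x, of l] carrier_matD[OF Ak] i by simp
      also have "\<dots> \<le> (A ^\<^sub>m k *\<^sub>v (A *\<^sub>v x)) $ i"
        using ge x A(1) nonneg i by (intro mult_mat_vec_mono[OF Ak]) auto
      also have "\<dots> = (A ^\<^sub>m Suc k *\<^sub>v x) $ i"
        using assoc_mult_mat_vec[OF Ak A(1) x] by simp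
      finally show "l ^ Suc k * x $ i \<le> (A ^\<^sub>m Suc k *\<^sub>v x) $ i" .
    qed
  qed
  then show ?thesis using i by blast
qed

text \<open>Otherwise, dividing \<open>A\<close> by a number strictly between its spectral radius
  and \<open>l\<close> gives powers with bounded entries, while the iterated inequality forces
  geometric growth on \<open>x\<close>.\<close>

lemma spectral_radius_ge_subeigenvector:
  fixes A :: "real mat"
  assumes A: "A \<in> carrier_mat n n" "\<And>i j. i < n \<Longrightarrow> j < n \<Longrightarrow> A $$ (i, j) \<ge> 0" and n: "n > 0"
    and x: "x \<in> carrier_vec n" "\<And>i. i < n \<Longrightarrow> x $ i > 0"
    and ge: "\<And>i. i < n \<Longrightarrow> l * x $ i \<le> (A *\<^sub>v x) $ i"
  shows "l \<le> spectral_radius (map_mat complex_of_real A)"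
proof (rule ccontr)
  let ?A = "map_mat complex_of_real A"
  assume "\<not> ?thesis"
  then obtain m where m: "spectral_radius ?A < m" "m < l" using dense by (meson not_le)
  have A': "?A \<in> carrier_mat n n" using A(1) by simp
  have "0 \<le> spectral_radius ?A"
    using spectral_radius_attained[OF A' n] by (metis norm_ge_zero)
  then have m0: "m > 0" using m by simp
  define B where "B = (1 / m) \<cdot>\<^sub>m A"
  let ?B = "map_mat complex_of_real B"
  have B: "B \<in> carrier_mat n n" "\<And>i j. i < n \<Longrightarrow> j < n \<Longrightarrow> B $$ (i, j) \<ge> 0"
    using A m0 by (auto simp: B_def)
  have B': "?B \<in> carrier_mat n n" using B(1) by simp
  have AB: "?A = complex_of_real m \<cdot>\<^sub>m ?B"
    by (rule eq_matI) (use m0 in \<open>auto simp: B_def\<close>)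
  obtain e v where v: "v \<in> carrier_vec n" "v \<noteq> 0\<^sub>v n" "?B *\<^sub>v v = e \<cdot>\<^sub>v v"
    and e: "norm e = spectral_radius ?B"
    using spectral_radius_attained[OF B' n] .
  have "?A *\<^sub>v v = (complex_of_real m * e) \<cdot>\<^sub>v v"
    unfolding AB smult_mat_mult_vec[OF B' v(1)] v(3) by (simp add: smult_smult_assoc)
  then have "eigenvalue ?A (complex_of_real m * e)"
    using v A(1) unfolding eigenvalue_def eigenvector_def by auto
  from eigenvalue_norm_le_spectral_radius[OF A' this] m0
  have "m * norm e \<le> spectral_radius ?A" by (simp add: norm_mult)
  then have "m * norm e < m * 1" using m(1) by linarith
  then have "spectral_radius ?B < 1" using m0 e by simp
  \<comment> \<open>A spectral radius below 1 yields one constant bounding the entries of all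
    powers.\<close>
  from spectral_radius_jnf_norm_bound_less_1_upper_triangular[OF B' this]
  obtain c where c: "norm_bound (?B ^\<^sub>m k) c" for k by blast
  have Bc: "(B ^\<^sub>m k) $$ (i, j) \<le> c" if "i < n" "j < n" for i j k
  proof -
    have "norm ((?B ^\<^sub>m k) $$ (i, j)) \<le> c"
      using c[of k] that unfolding norm_bound_def carrier_matD[OF pow_carrier_mat[OF B', of k]] by blast
    also have "?B ^\<^sub>m k = map_mat complex_of_real (B ^\<^sub>m k)"
      using of_real_hom.mat_hom_pow[OF B(1)] by metis
    also have "\<dots> $$ (i, j) = complex_of_real ((B ^\<^sub>m k) $$ (i, j))"
      using that carrier_matD[OF pow_carrier_mat[OF B(1), of k]] by (metis index_map_mat(1))
    finally show ?thesis by simp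
  qed
  have "(l / m) * x $ i \<le> (B *\<^sub>v x) $ i" if "i < n" for i
    using ge[OF that] m0 that A(1) x(1) unfolding B_def
    by (simp add: smult_mat_mult_vec[OF A(1) x(1)] divide_right_mono)
  from pow_mat_mult_vec_ge[OF B x(1) this _ n]
  have "(l / m) ^ k * x $ 0 \<le> (B ^\<^sub>m k *\<^sub>v x) $ 0" for k using m m0 by simp
  also have "(B ^\<^sub>m k *\<^sub>v x) $ 0 \<le> (\<Sum>j<n. c * x $ j)" for k
    unfolding index_mult_mat_vec_sum[OF pow_carrier_mat[OF B(1)] x(1) n]
    by (intro sum_mono mult_right_mono) (use Bc n x(2) in \<open>auto simp: less_imp_le\<close>)
  finally have bd: "(l / m) ^ k \<le> (\<Sum>j<n. c * x $ j) / x $ 0" for k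
    using x(2)[OF n] by (simp add: field_simps)
  have "1 < l / m" using m m0 by simp
  from real_arch_pow[OF this] obtain k where "(\<Sum>j<n. c * x $ j) / x $ 0 < (l / m) ^ k" by blast
  with bd[of k] show False by simp
qed

text \<open>With \<open>w = A x - l x\<close>, the vector \<open>(A + 1) w\<close> is positive in every coordinate, so
  \<open>A x + x\<close> satisfies the inequality for a slightly larger \<open>l\<close>.\<close>

lemma spectral_radius_gt_subeigenvector:
  fixes A :: "real mat"
  assumes A: "A \<in> carrier_mat n n" "\<And>i j. i < n \<Longrightarrow> j < n \<Longrightarrow> A $$ (i, j) \<ge> 0"
    and off: "\<And>i j. i < n \<Longrightarrow> j < n \<Longrightarrow> i \<noteq> j \<Longrightarrow> A $$ (i, j) > 0"
    and x: "x \<in> carrier_vec n" "\<And>i. i < n \<Longrightarrow> x $ i > 0"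
    and ge: "\<And>i. i < n \<Longrightarrow> l * x $ i \<le> (A *\<^sub>v x) $ i"
    and i0: "i0 < n" "l * x $ i0 < (A *\<^sub>v x) $ i0"
  shows "l < spectral_radius (map_mat complex_of_real A)"
proof -
  define z where "z = A *\<^sub>v x + x"
  have Ax: "A *\<^sub>v x \<in> carrier_vec n" using A(1) x(1) by simp
  have z: "z \<in> carrier_vec n" using Ax x(1) by (simp add: z_def)
  have zi: "z $ i = (A *\<^sub>v x) $ i + x $ i" if "i < n" for i
    using that x(1) by (simp add: z_def)
  have zpos: "z $ i > 0" if "i < n" for i
  proof -
    have "(A *\<^sub>v x) $ i \<ge> 0" unfolding index_mult_mat_vec_sum[OF A(1) x(1) that]
      using A(2) x(2) that by (intro sum_nonneg mult_nonneg_nonneg) (auto simp: less_imp_le)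
    then show ?thesis using zi[OF that] x(2)[OF that] by simp
  qed
  define w where "w j = (A *\<^sub>v x) $ j - l * x $ j" for j
  have w: "w j \<ge> 0" if "j < n" for j using ge[OF that] by (simp add: w_def)
  have Az: "(A *\<^sub>v z) $ i - l * z $ i = (\<Sum>j<n. A $$ (i, j) * w j) + w i" if i: "i < n" for i
  proof -
    have "(A *\<^sub>v z) $ i = (\<Sum>j<n. A $$ (i, j) * (w j + l * x $ j)) + (A *\<^sub>v x) $ i"
      unfolding z_def mult_add_distrib_mat_vec[OF A(1) Ax x(1)]
      using index_mult_mat_vec_sum[OF A(1) Ax i] Ax x(1) A(1) i
      by (simp add: w_def)
    also have "(\<Sum>j<n. A $$ (i, j) * (w j + l * x $ j)) =
      (\<Sum>j<n. A $$ (i, j) * w j) + l * (A *\<^sub>v x) $ i"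
      unfolding index_mult_mat_vec_sum[OF A(1) x(1) i]
      by (simp add: distrib_left sum.distrib sum_distrib_left mult_ac)
    finally show ?thesis using zi[OF i] by (simp add: w_def algebra_simps)
  qed
  have strict: "l * z $ i < (A *\<^sub>v z) $ i" if i: "i < n" for i
  proof (cases "i = i0")
    case True
    have "(\<Sum>j<n. A $$ (i, j) * w j) \<ge> 0" using A(2) w i by (intro sum_nonneg) auto
    then show ?thesis using Az[OF i] i0(2) True by (simp add: w_def)
  next
    case False
    have "0 < A $$ (i, i0) * w i0" using off[OF i i0(1) False] i0(2) by (simp add: w_def)
    also have "\<dots> \<le> (\<Sum>j<n. A $$ (i, j) * w j)"
      using A(2) w i i0(1) by (intro member_le_sum) auto
    finally show ?thesis using Az[OF i] w[OF i] by simp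
  qed
  \<comment> \<open>The smallest relative excess over the finitely many coordinates, so that
    \<open>l + e\<close> works for all of them at once.\<close>
  define e where "e = Min ((\<lambda>i. ((A *\<^sub>v z) $ i - l * z $ i) / z $ i) ` {..<n})"
  have e0: "e > 0" unfolding e_def using i0(1) strict zpos by (subst Min_gr_iff) auto
  have "(l + e) * z $ i \<le> (A *\<^sub>v z) $ i" if i: "i < n" for i
  proof -
    have "e \<le> ((A *\<^sub>v z) $ i - l * z $ i) / z $ i" unfolding e_def using i by (intro Min_le) auto
    then show ?thesis using zpos[OF i] by (simp add: field_simps)
  qed
  from spectral_radius_ge_subeigenvector[OF A _ z zpos this] i0(1) e0 show ?thesis by simp
qed

section \<open>Distances in complete multipartite graphs\<close>

lemma (in wf_digraph) awalk_cost_unit: "awalk_cost (\<lambda>_. 1) p = real (length p)"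
  by (induction p) simp_all

lemma vdist_le_awalk_length:
  assumes "pair_graph G" "pre_digraph.awalk (with_proj G) u p v"
  shows "vdist G u v \<le> real (length p)"
proof -
  interpret pair_graph G by fact
  have "\<mu> (\<lambda>_. 1) u v \<le> ereal (length p)"
    using min_cost_le_walk_cost[OF assms(2), of "\<lambda>_. 1"] by (simp add: awalk_cost_unit)
  moreover have "0 \<le> \<mu> (\<lambda>_. 1) u v"
    unfolding \<mu>_def by (rule INF_greatest) (simp add: awalk_cost_unit)
  ultimately show ?thesis unfolding vdist_def
    by (cases "\<mu> (\<lambda>_. 1) u v") auto
qed

lemma vdist_awalk:
  assumes "pair_graph G" "u \<rightarrow>\<^sup>*\<^bsub>with_proj G\<^esub> v"
  obtains p where "pre_digraph.awalk (with_proj G) u p v" "vdist G u v = real (length p)"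
proof -
  interpret pair_graph G by fact
  obtain p where p: "apath u p v" "\<mu> (\<lambda>_. 1) u v = awalk_cost (\<lambda>_. 1) p"
    using min_cost_awalk[of u v "\<lambda>_. 1"] assms(2) by auto
  then show thesis using that by (auto simp: vdist_def apath_def awalk_cost_unit)
qed

text \<open>A walk of length 0 has equal ends and a walk of length 1 is an arc. Reachability
  matters: with no walk the infimum is infinite, and \<open>real_of_ereal\<close> would turn it into
  0.\<close>

lemma vdist_lower_bound:
  assumes G: "pair_graph G" and reach: "u \<rightarrow>\<^sup>*\<^bsub>with_proj G\<^esub> v"
  shows "(if u = v then 0 else if (u, v) \<in> parcs G then 1 else 2) \<le> vdist G u v"
proof -
  interpret pair_graph G by fact
  obtain p where p: "awalk u p v" "vdist G u v = real (length p)"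
    using vdist_awalk[OF G reach] .
  show ?thesis
  proof (cases p)
    case Nil
    then show ?thesis using p by (auto simp: awalk_Nil_iff)
  next
    case (Cons a q)
    show ?thesis
    proof (cases q)
      case Nil
      then have "a = (u, v)" "a \<in> parcs G" using p(1) Cons
        by (auto simp: awalk_Cons_iff awalk_Nil_iff intro: prod_eqI)
      then show ?thesis using p(2) Cons by auto
    qed (use p(2) Cons in auto)
  qed
qed

text \<open>The parts are the fibres of \<open>c\<close>. Giving them by a labelling treats proper
  colourings and residues modulo \<open>r\<close> alike.\<close>

definition complete_multipartite :: "'a pair_pre_digraph \<Rightarrow> ('a \<Rightarrow> nat) \<Rightarrow> bool" where
  "complete_multipartite G c \<longleftrightarrow>
     parcs G = {(u, v). u \<in> pverts G \<and> v \<in> pverts G \<and> c u \<noteq> c v}"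

text \<open>The distance in the complete multipartite graph on the fibres of \<open>c\<close>,
  provided there are at least two nonempty fibres. It is also used as a lower bound when
  \<open>c\<close> merely colours \<open>G\<close> properly.\<close>

definition multipartite_dist :: "('a \<Rightarrow> nat) \<Rightarrow> 'a \<Rightarrow> 'a \<Rightarrow> real" where
  "multipartite_dist c u v = (if u = v then 0 else if c u = c v then 2 else 1)"

text \<open>Distinct vertices of one part are joined by a walk of length 2 through another part;
  \<open>a\<close> and \<open>b\<close> guarantee that another part is inhabited.\<close>

lemma vdist_complete_multipartite:
  assumes G: "pair_graph G" and c: "complete_multipartite G c"
    and two: "a \<in> pverts G" "b \<in> pverts G" "c a \<noteq> c b"
    and uv: "u \<in> pverts G" "v \<in> pverts G"
  shows "vdist G u v = multipartite_dist c u v"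
proof -
  interpret pair_graph G by fact
  have arc: "(x, y) \<in> parcs G \<longleftrightarrow> x \<in> pverts G \<and> y \<in> pverts G \<and> c x \<noteq> c y" for x y
    using c by (auto simp: complete_multipartite_def)
  obtain p where p: "awalk u p v" "real (length p) \<le> multipartite_dist c u v"
  proof (cases "u = v")
    case True
    then show thesis using that[of "[]"] uv by (simp add: awalk_Nil_iff multipartite_dist_def)
  next
    case neq: False
    show thesis
    proof (cases "c u = c v")
      case True
      obtain w where w: "w \<in> pverts G" "c w \<noteq> c u" using two by metis
      then have "awalk u [(u, w), (w, v)] v"
        using uv True arc by (simp add: awalk_Cons_iff awalk_Nil_iff)
      then show thesis using that True neq by (fastforce simp: multipartite_dist_def)
    next
      case False
      then have "awalk u [(u, v)] v" using uv arc by (simp add: awalk_Cons_iff awalk_Nil_iff)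
      then show thesis using that False neq by (fastforce simp: multipartite_dist_def)
    qed
  qed
  have reach: "u \<rightarrow>\<^sup>*\<^bsub>with_proj G\<^esub> v" using p(1) reachable_awalkI by blast
  have "multipartite_dist c u v \<le> vdist G u v"
    using vdist_lower_bound[OF G reach] arc[of u v] by (auto simp: multipartite_dist_def split: if_splits)
  with vdist_le_awalk_length[OF G p(1)] p(2) show ?thesis by linarith
qed

text \<open>Vertices of equal colour are not adjacent, hence at distance at least 2 when distinct.
  The second claim is the source of strictness when an arc between two parts is missing.\<close>

lemma multipartite_dist_le_vdist:
  assumes G: "pair_graph G" "Digraph_Component.connected (with_proj G)"
    and c: "proper_coloring G k c" and uv: "u \<in> pverts G" "v \<in> pverts G"
  shows "multipartite_dist c u v \<le> vdist G u v"
    and "c u \<noteq> c v \<Longrightarrow> (u, v) \<notin> parcs G \<Longrightarrow> multipartite_dist c u v < vdist G u v"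
proof -
  interpret pair_graph G by fact
  have "strongly_connected (with_proj G)"
    using symmetric_connected_imp_strongly_connected sym_arcs G(2) by blast
  then have reach: "u \<rightarrow>\<^sup>*\<^bsub>with_proj G\<^esub> v" using uv by (auto simp: strongly_connected_def)
  have "(u, v) \<in> parcs G \<Longrightarrow> c u \<noteq> c v" using c by (auto simp: proper_coloring_def)
  with vdist_lower_bound[OF G(1) reach]
  show "multipartite_dist c u v \<le> vdist G u v"
    and "c u \<noteq> c v \<Longrightarrow> (u, v) \<notin> parcs G \<Longrightarrow> multipartite_dist c u v < vdist G u v"
    by (auto simp: multipartite_dist_def split: if_splits)
qed

lemma vdist_nonneg: "0 \<le> vdist G u v" if "pair_graph G"
proof -
  interpret pair_graph G by fact
  have "0 \<le> \<mu> (\<lambda>_. 1) u v"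
    unfolding \<mu>_def by (rule INF_greatest) (simp add: awalk_cost_unit)
  then show ?thesis unfolding vdist_def by (rule real_of_ereal_pos)
qed

lemma vertex_list_nth:
  assumes "pair_graph G"
  shows "length (vertex_list G) = card (pverts G)"
    and "bij_betw (\<lambda>i. vertex_list G ! i) {..<card (pverts G)} (pverts G)"
proof -
  show len: "length (vertex_list G) = card (pverts G)"
    using vertex_list[OF assms] by (metis distinct_card)
  show "bij_betw (\<lambda>i. vertex_list G ! i) {..<card (pverts G)} (pverts G)"
    using vertex_list[OF assms] len by (intro bij_betw_nth) auto
qed

section \<open>The generalized distance matrix acting on functions of the vertices\<close>

lemma gen_distance_mat_carrier:
  "gen_distance_mat \<alpha> G \<in> carrier_mat (card (pverts G)) (card (pverts G))"
  by (simp add: gen_distance_mat_def distance_mat_def transmission_mat_def Let_def)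

lemma gen_distance_mat_index:
  assumes "i < card (pverts G)" "j < card (pverts G)"
  shows "gen_distance_mat \<alpha> G $$ (i, j) =
    (if i = j then \<alpha> * transmission G (vertex_list G ! i) else 0)
    + (1 - \<alpha>) * vdist G (vertex_list G ! i) (vertex_list G ! j)"
  using assms
  by (simp add: gen_distance_mat_def distance_mat_def transmission_mat_def Let_def mat_diag_def)

text \<open>The action of \<open>gen_distance_mat\<close> on functions on the vertex set; its coefficients
  \<open>\<alpha> h(u) + (1 - \<alpha>) h(v)\<close> show that it is monotone in the distances when \<open>h\<close> is positive.\<close>

definition gen_distance_op :: "real \<Rightarrow> 'a set \<Rightarrow> ('a \<Rightarrow> 'a \<Rightarrow> real) \<Rightarrow> ('a \<Rightarrow> real) \<Rightarrow> 'a \<Rightarrow> real" where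
  "gen_distance_op \<alpha> V \<delta> h u = (\<Sum>v\<in>V. \<delta> u v * (\<alpha> * h u + (1 - \<alpha>) * h v))"

text \<open>The transmission on the diagonal is a sum over the same distances as the row, so both
  merge into one sum, free of the chosen vertex order.\<close>

lemma gen_distance_mat_mult_vec:
  assumes G: "pair_graph G" and i: "i < card (pverts G)"
  shows "(gen_distance_mat \<alpha> G *\<^sub>v vec (card (pverts G)) (\<lambda>j. h (vertex_list G ! j))) $ i =
    gen_distance_op \<alpha> (pverts G) (vdist G) h (vertex_list G ! i)"
proof -
  let ?n = "card (pverts G)" and ?v = "\<lambda>j. vertex_list G ! j"
  have "(gen_distance_mat \<alpha> G *\<^sub>v vec ?n (\<lambda>j. h (?v j))) $ i =
    (\<Sum>j<?n. gen_distance_mat \<alpha> G $$ (i, j) * h (?v j))"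
    using i gen_distance_mat_carrier[of \<alpha> G] by (simp add: scalar_prod_def atLeast0LessThan)
  also have "\<dots> = (\<Sum>j<?n. (if i = j then \<alpha> * transmission G (?v i) * h (?v i) else 0)
      + (1 - \<alpha>) * vdist G (?v i) (?v j) * h (?v j))"
    using i by (intro sum.cong) (auto simp: gen_distance_mat_index algebra_simps)
  also have "\<dots> = \<alpha> * transmission G (?v i) * h (?v i)
      + (\<Sum>j<?n. (1 - \<alpha>) * vdist G (?v i) (?v j) * h (?v j))"
    using i by (simp add: sum.distrib)
  also have "(\<Sum>j<?n. (1 - \<alpha>) * vdist G (?v i) (?v j) * h (?v j)) =
      (\<Sum>v\<in>pverts G. (1 - \<alpha>) * vdist G (?v i) v * h v)"
    by (rule sum.reindex_bij_betw[OF vertex_list_nth(2)[OF G]])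
  finally show ?thesis
    by (simp add: gen_distance_op_def transmission_def sum_distrib_left sum_distrib_right
        sum.distrib[symmetric] algebra_simps)
qed

text \<open>The distance is 1, plus 1 inside a part, minus 2 on the diagonal. On functions constant
  on parts, the operator thus reduces to one equation per part.\<close>

lemma gen_distance_op_multipartite:
  fixes x :: "nat \<Rightarrow> real" and \<alpha> :: real
  assumes V: "finite V" and c: "\<And>v. v \<in> V \<Longrightarrow> c v < r" and u: "u \<in> V"
  defines "m \<equiv> \<lambda>k. card {v \<in> V. c v = k}"
  shows "gen_distance_op \<alpha> V (multipartite_dist c) (\<lambda>v. x (c v)) u =
    (\<alpha> * card V + m (c u) - 2) * x (c u) + (1 - \<alpha>) * (\<Sum>k<r. m k * x k)"
proof -
  let ?g = "\<lambda>v. \<alpha> * x (c u) + (1 - \<alpha>) * x (c v)"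
  have "gen_distance_op \<alpha> V (multipartite_dist c) (\<lambda>v. x (c v)) u =
    (\<Sum>v\<in>V. ?g v + (if c v = c u then ?g v else 0) - (if v = u then 2 * ?g v else 0))"
    unfolding gen_distance_op_def by (intro sum.cong) (auto simp: multipartite_dist_def)
  also have "\<dots> = (\<Sum>v\<in>V. ?g v) + (\<Sum>v\<in>{v \<in> V. c v = c u}. ?g v) - 2 * ?g u"
    using V u by (simp add: sum.distrib sum_subtractf sum.inter_filter[symmetric])
  also have "(\<Sum>v\<in>{v \<in> V. c v = c u}. ?g v) = m (c u) * x (c u)"
    by (simp add: m_def algebra_simps)
  also have "(\<Sum>v\<in>V. ?g v) = card V * \<alpha> * x (c u) + (1 - \<alpha>) * (\<Sum>v\<in>V. x (c v))"
    by (simp add: sum.distrib sum_distrib_left)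
  also have "(\<Sum>v\<in>V. x (c v)) = (\<Sum>k<r. \<Sum>v\<in>{v \<in> V. c v = k}. x (c v))"
    using c by (intro sum.group[symmetric] V) auto
  also have "\<dots> = (\<Sum>k<r. m k * x k)" by (simp add: m_def)
  finally show ?thesis by (simp add: algebra_simps)
qed

section \<open>Counting and matching fibres\<close>

lemma sum_card_fibres:
  assumes "finite V" "\<And>v. v \<in> V \<Longrightarrow> c v < (r::nat)"
  shows "(\<Sum>k<r. card {v \<in> V. c v = k}) = card V"
proof -
  have "(\<Sum>k<r. \<Sum>v\<in>{v \<in> V. c v = k}. 1) = (\<Sum>v\<in>V. 1::nat)"
    using assms by (intro sum.group) auto
  then show ?thesis by simp
qed

text \<open>Bijections between the individual fibres are glued together. This serves first to match
  parts by size and then vertices by part.\<close>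

lemma fibrewise_bijection:
  assumes "finite A" "finite B" and eq: "\<And>k. card {a \<in> A. p a = k} = card {b \<in> B. q b = k}"
  obtains f where "bij_betw f A B" "\<And>a. a \<in> A \<Longrightarrow> q (f a) = p a"
proof -
  have "\<exists>g. bij_betw g {a \<in> A. p a = k} {b \<in> B. q b = k}" for k
    using assms by (intro finite_same_card_bij) auto
  then obtain g where g: "bij_betw (g k) {a \<in> A. p a = k} {b \<in> B. q b = k}" for k by metis
  define f where "f a = g (p a) a" for a
  have f: "f a \<in> B \<and> q (f a) = p a" if "a \<in> A" for a
    using bij_betwE[OF g[of "p a"]] that by (auto simp: f_def)
  show thesis
  proof
    show "bij_betw f A B"
      unfolding bij_betw_def
    proof
      show "inj_on f A"
      proof (rule inj_onI)
        fix a a' assume a: "a \<in> A" "a' \<in> A" "f a = f a'"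
        then have "p a = p a'" using f by metis
        then show "a = a'"
          using a bij_betw_imp_inj_on[OF g[of "p a"]] by (auto simp: f_def inj_on_def)
      qed
      show "f ` A = B"
      proof (intro equalityI subsetI)
        fix b assume "b \<in> B"
        then have "b \<in> g (q b) ` {a \<in> A. p a = q b}" using g[of "q b"] by (auto simp: bij_betw_def)
        then obtain a where "a \<in> A" "f a = b" by (auto simp: f_def)
        then show "b \<in> f ` A" by blast
      qed (use f in auto)
    qed
  qed (use f in auto)
qed

section \<open>Part sizes\<close>

locale turan_parameters =
  fixes n r d s :: nat and \<alpha> :: real
  assumes r: "3 \<le> r" and n_gt: "r < n" and n: "n = r * d + s" and s: "s < r"
    and \<alpha>: "0 \<le> \<alpha>" "\<alpha> \<le> 1 - 1 / real r"
begin

text \<open>The denominators \<open>t - m\<close> for parts of size \<open>d\<close> and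
  \<open>d + 1\<close> are \<open>y\<close> and \<open>y - 1\<close>.\<close>

definition y :: real where
  "y = (1 + (1 - \<alpha>) * n + sqrt ((n * (1 - \<alpha>) - 1)\<^sup>2 + 4 * s * (1 - \<alpha>) * (d + 1))) / 2"

definition t :: real where "t = d + y"

definition rad :: real where "rad = t + \<alpha> * n - 2"

lemma \<alpha>_less_1: "\<alpha> < 1"
proof -
  have "0 < 1 / real r" using r by simp
  with \<alpha>(2) show ?thesis by linarith
qed

lemma d_pos: "0 < d"
  using n_gt n s by (cases d) auto

text \<open>The bound on \<alpha> and \<open>r < n\<close> give
  \<open>(1 - \<alpha>) * n > 1\<close>, and the square root is at least
  \<open>(1 - \<alpha>) * n - 1\<close>. This makes the weights of balanced parts positive.\<close>

lemma y_gt_1: "1 < y"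
proof -
  have r0: "0 < real r" using r by simp
  have "1 < n / real r" using n_gt r0 by simp
  also have "\<dots> = (1 / real r) * n" by simp
  also have "\<dots> \<le> (1 - \<alpha>) * n" using \<alpha>(2) by (intro mult_right_mono) auto
  finally have "1 < (1 - \<alpha>) * n" .
  moreover have "\<bar>n * (1 - \<alpha>) - 1\<bar> \<le>
    sqrt ((n * (1 - \<alpha>) - 1)\<^sup>2 + 4 * s * (1 - \<alpha>) * (d + 1))"
    using \<alpha>_less_1 by (intro real_le_rsqrt) (simp add: mult_nonneg_nonneg)
  ultimately show ?thesis unfolding y_def by (simp add: mult.commute)
qed

lemma t_gt: "d + 1 < t" "0 < t"
  using y_gt_1 by (auto simp: t_def)

lemma real_n: "real n = real r * d + s"
  using n by simp

text \<open>This is \<open>(1 - \<alpha>) * ((r - s) * d / y + s * (d + 1) / (y - 1)) = 1\<close>,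
  the balanced weight equation, with denominators cleared.\<close>

lemma y_quadratic: "y\<^sup>2 - y = (1 - \<alpha>) * (n * y - (real r - s) * d)"
proof -
  define b where "b = 1 + (1 - \<alpha>) * n"
  define q where "q = sqrt ((n * (1 - \<alpha>) - 1)\<^sup>2 + 4 * s * (1 - \<alpha>) * (d + 1))"
  have "q\<^sup>2 = (n * (1 - \<alpha>) - 1)\<^sup>2 + 4 * s * (1 - \<alpha>) * (d + 1)"
    unfolding q_def using \<alpha>_less_1 by (intro real_sqrt_pow2 add_nonneg_nonneg) auto
  also have "\<dots> = b\<^sup>2 - 4 * (1 - \<alpha>) * ((real r - s) * d)"
    unfolding b_def real_n by (simp add: power2_eq_square algebra_simps)
  finally have q: "q\<^sup>2 = b\<^sup>2 - 4 * (1 - \<alpha>) * ((real r - s) * d)" .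
  have y: "y = (b + q) / 2" by (simp add: y_def b_def q_def)
  have "y\<^sup>2 = b * y - (b\<^sup>2 - q\<^sup>2) / 4"
    unfolding y by (simp add: power2_eq_square field_simps)
  also have "\<dots> = b * y - (1 - \<alpha>) * ((real r - s) * d)" unfolding q by simp
  finally show ?thesis by (simp add: b_def algebra_simps)
qed

text \<open>The chord of the convex function \<open>z \<mapsto> z / (t - z)\<close> through its points at \<open>d\<close> and \<open>d + 1\<close>.\<close>

definition chord :: "nat \<Rightarrow> real" where
  "chord m = d / y + (real m - d) * (t / (y * (y - 1)))"

text \<open>The chord is affine, so its sum depends only on the total \<open>n\<close>; the
  quadratic equation for \<open>y\<close> then evaluates it.\<close>

lemma sum_chord:
  assumes "(\<Sum>k<r. m k) = n"
  shows "(1 - \<alpha>) * (\<Sum>k<r. chord (m k)) = 1"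
proof -
  have y: "y \<noteq> 0" "y - 1 \<noteq> 0" using y_gt_1 by auto
  have "(\<Sum>k<r. chord (m k)) = r * (d / y) + (\<Sum>k<r. real (m k) - d) * (t / (y * (y - 1)))"
    unfolding chord_def by (simp add: sum.distrib sum_distrib_right sum_divide_distrib)
  also have "(\<Sum>k<r. real (m k) - d) = real n - r * d"
    using assms by (simp add: sum_subtractf of_nat_sum[symmetric] del: of_nat_sum)
  also have "\<dots> = s" by (simp add: real_n)
  also have "r * (d / y) + s * (t / (y * (y - 1))) = (n * y - (real r - s) * d) / (y\<^sup>2 - y)"
    using y unfolding t_def real_n
    by (simp add: power2_eq_square divide_simps) (simp add: algebra_simps)
  also have "(1 - \<alpha>) * \<dots> = 1"
  proof -
    have "y\<^sup>2 - y \<noteq> 0" using y by (simp add: power2_eq_square)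
    then show ?thesis using y_quadratic by simp
  qed
  finally show ?thesis .
qed

text \<open>The numerator contains a product of two consecutive integers, which vanishes at
  \<open>d\<close> and \<open>d + 1\<close> and is positive at every other natural number. This is
  the convexity needed.\<close>

lemma chord_diff:
  assumes "real m < t"
  shows "m / (t - m) - chord m =
    t * ((real m - d) * (real m - d - 1)) / (y * (y - 1) * (t - m))"
proof -
  have "y \<noteq> 0" "y - 1 \<noteq> 0" "t - m \<noteq> 0" using y_gt_1 assms by auto
  then show ?thesis unfolding chord_def
    by (simp add: divide_simps) (simp add: t_def algebra_simps)
qed

lemma chord_eq:
  assumes "m \<in> {d, d + 1}"
  shows "chord m = m / (t - m)" "real m < t"
proof -
  show "real m < t" using assms t_gt by auto
  from chord_diff[OF this] assms show "chord m = m / (t - m)" by auto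
qed

lemma chord_less:
  assumes "real m < t" "m \<notin> {d, d + 1}"
  shows "chord m < m / (t - m)"
proof -
  have "0 < (real m - d) * (real m - d - 1)"
  proof (cases "m < d")
    case True
    then show ?thesis by (intro mult_neg_neg) auto
  next
    case False
    then have "d + 1 < m" using assms(2) by auto
    then have "real d + 1 < m" by linarith
    then show ?thesis by (intro mult_pos_pos) auto
  qed
  then have "0 < t * ((real m - d) * (real m - d - 1)) / (y * (y - 1) * (t - m))"
    using assms(1) y_gt_1 t_gt by simp
  with chord_diff[OF assms(1)] show ?thesis by simp
qed

text \<open>Curve and chord agree at \<open>d\<close> and \<open>d + 1\<close>. Hence the weights
  \<open>1 / (t - m k)\<close> turn the inequality for each part into an equality.\<close>

lemma balanced_weights:
  assumes "(\<Sum>k<r. m k) = n" "\<And>k. k < r \<Longrightarrow> m k \<in> {d, d + 1}"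
  shows "(1 - \<alpha>) * (\<Sum>k<r. m k * (1 / (t - m k))) = 1"
proof -
  have "(\<Sum>k<r. chord (m k)) = (\<Sum>k<r. m k * (1 / (t - m k)))"
    using assms(2) chord_eq(1) by (intro sum.cong) auto
  with sum_chord[OF assms(1)] show ?thesis by simp
qed

text \<open>A part of size at least \<open>t\<close> dominates all others, so a weight concentrated on it suffices.\<close>

lemma unbalanced_weights:
  assumes sum: "(\<Sum>k<r. m k) = n" and "k0 < r" "m k0 \<notin> {d, d + 1}"
  obtains x :: "nat \<Rightarrow> real" where "\<And>k. k < r \<Longrightarrow> 0 < x k"
    "\<And>k. k < r \<Longrightarrow> (t - m k) * x k < (1 - \<alpha>) * (\<Sum>j<r. m j * x j)"
proof (cases "\<forall>k<r. real (m k) < t")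
  case True
  define x where "x k = 1 / (t - m k)" for k
  have le: "chord (m k) \<le> m k * x k" if "k < r" for k
    using chord_eq(1)[of "m k"] chord_less[of "m k"] True that
    by (cases "m k \<in> {d, d + 1}") (auto simp: x_def)
  have "chord (m k0) < m k0 * x k0" using chord_less assms True by (simp add: x_def)
  then have "(\<Sum>k<r. chord (m k)) < (\<Sum>k<r. m k * x k)"
    using le \<open>k0 < r\<close> by (intro sum_strict_mono_ex1) auto
  then have "(1 - \<alpha>) * (\<Sum>k<r. chord (m k)) < (1 - \<alpha>) * (\<Sum>k<r. m k * x k)"
    using \<alpha>_less_1 by (intro mult_strict_left_mono) auto
  then have "1 < (1 - \<alpha>) * (\<Sum>k<r. m k * x k)" using sum_chord[OF sum] by simp
  moreover have "0 < x k" "(t - m k) * x k = 1" if "k < r" for k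
    using True that by (auto simp: x_def)
  ultimately show thesis using that[of x] by auto
next
  case False
  then obtain k1 where k1: "k1 < r" "t \<le> m k1" by force
  have mpos: "0 < real (m k1)" using k1 t_gt by linarith
  \<comment> \<open>Chosen so that \<open>t * e\<close> is half of
    \<open>(1 - \<alpha>) * m k1\<close>, the contribution of the large part alone.\<close>
  define e where "e = (1 - \<alpha>) * m k1 / (2 * t)"
  have e: "0 < e" using \<alpha>_less_1 mpos t_gt by (simp add: e_def)
  define x where "x k = (if k = k1 then 1 else e)" for k
  have xpos: "0 < x k" for k using e by (simp add: x_def)
  have S: "real (m k1) * x k1 \<le> (\<Sum>j<r. m j * x j)"
    using k1 xpos by (intro member_le_sum) (auto simp: less_imp_le)
  have S': "(1 - \<alpha>) * m k1 \<le> (1 - \<alpha>) * (\<Sum>j<r. m j * x j)"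
    using S \<alpha>_less_1 by (intro mult_left_mono) (auto simp: x_def)
  have "(t - m k) * x k < (1 - \<alpha>) * (\<Sum>j<r. m j * x j)" if "k < r" for k
  proof (cases "k = k1")
    case True
    have "(t - m k) * x k \<le> 0" using k1 True by (simp add: x_def)
    also have "0 < (1 - \<alpha>) * m k1" using \<alpha>_less_1 mpos by simp
    finally show ?thesis using S' by simp
  next
    case False
    have "(t - m k) * x k \<le> t * e"
      using False e by (simp add: x_def)
    also have "t * e = (1 - \<alpha>) * m k1 / 2" using t_gt by (simp add: e_def)
    also have "\<dots> < (1 - \<alpha>) * m k1" using \<alpha>_less_1 mpos by simp
    finally show ?thesis using S' by simp
  qed
  then show thesis using that xpos by blast
qed

text \<open>The excess of \<open>n\<close> over \<open>r * d\<close> counts the large parts. Thus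
  balanced partitions have the same number of parts of each size.\<close>

lemma card_parts_of_size:
  assumes sum: "(\<Sum>k<r. m k) = n" and m: "\<And>k. k < r \<Longrightarrow> m k \<in> {d, d + 1}"
  shows "card {k \<in> {..<r}. m k = e} = (if e = d + 1 then s else if e = d then r - s else 0)"
proof -
  have "n = (\<Sum>k<r. d + (if m k = d + 1 then 1 else 0))"
    unfolding sum[symmetric] using m by (intro sum.cong) auto
  also have "\<dots> = r * d + card {k \<in> {..<r}. m k = d + 1}"
    by (simp add: sum.distrib sum.If_cases Int_def)
  finally have large: "card {k \<in> {..<r}. m k = d + 1} = s" using n by simp
  have "{k \<in> {..<r}. m k = d} = {..<r} - {k \<in> {..<r}. m k = d + 1}" using m by force
  then have small: "card {k \<in> {..<r}. m k = d} = r - s"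
    using large by (subst \<open>_ = _ - _\<close>, subst card_Diff_subset) auto
  show ?thesis using large small m by auto
qed

end

section \<open>Comparison with the Turan graph\<close>

lemma digraph_iso_complete_multipartite:
  assumes G: "pair_graph G" "complete_multipartite G c" and H: "complete_multipartite H c'"
    and f: "bij_betw f (pverts G) (pverts H)"
    and eq: "\<And>u v. u \<in> pverts G \<Longrightarrow> v \<in> pverts G \<Longrightarrow> c' (f u) = c' (f v) \<longleftrightarrow> c u = c v"
  shows "digraph_iso (with_proj G) (with_proj H)"
proof -
  interpret pair_graph G by fact
  \<comment> \<open>Tail and head maps are \<open>fst\<close> and \<open>snd\<close> so that the
    image is again of the form \<open>with_proj\<close>.\<close>
  define F where "F = \<lparr>iso_verts = f, iso_arcs = map_prod f f, iso_head = snd, iso_tail = fst\<rparr>"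
  have inj: "inj_on f (pverts G)" and img: "f ` pverts G = pverts H"
    using f by (auto simp: bij_betw_def)
  have arcs: "parcs G \<subseteq> pverts G \<times> pverts G" using G(2) by (auto simp: complete_multipartite_def)
  have "inj_on (map_prod f f) (parcs G)"
    using map_prod_inj_on[OF inj inj] arcs by (rule inj_on_subset)
  then have "digraph_isomorphism F"
    unfolding digraph_isomorphism_def F_def using inj wf_digraph_axioms by auto
  moreover have "map_prod f f ` parcs G = parcs H"
  proof (intro equalityI subsetI)
    fix a assume "a \<in> map_prod f f ` parcs G"
    then show "a \<in> parcs H"
      using G(2) H eq img by (fastforce simp: complete_multipartite_def)
  next
    fix a assume "a \<in> parcs H"
    then obtain u v where "a = (f u, f v)" "u \<in> pverts G" "v \<in> pverts G" "c' (f u) \<noteq> c' (f v)"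
      using H unfolding complete_multipartite_def img[symmetric] by auto
    then show "a \<in> map_prod f f ` parcs G"
      using G(2) eq by (force simp: complete_multipartite_def)
  qed
  then have "with_proj H = app_iso F (with_proj G)"
    by (intro pre_digraph.equality) (simp_all add: F_def img)
  ultimately show ?thesis unfolding digraph_iso_def by blast
qed

text \<open>A digraph isomorphism carries a separate map on arcs; compatibility with tails and heads
  forces it to be the product of the vertex map with itself, so adjacency in \<open>G\<close> is
  read off from labels in \<open>H\<close>.\<close>

lemma digraph_iso_complete_multipartite_pullback:
  assumes iso: "digraph_iso (with_proj G) (with_proj H)"
    and G: "pair_graph G" and H: "complete_multipartite H c"
  obtains f where "bij_betw f (pverts G) (pverts H)" "complete_multipartite G (\<lambda>v. c (f v))"
proof -
  interpret pair_graph G by fact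
  obtain F where F: "digraph_isomorphism F" "with_proj H = app_iso F (with_proj G)"
    using iso unfolding digraph_iso_def by blast
  let ?f = "iso_verts F"
  have inj: "inj_on ?f (pverts G)" using F(1) by (auto simp: digraph_isomorphism_def)
  have img: "pverts H = ?f ` pverts G" and arcs: "parcs H = iso_arcs F ` parcs G"
    using arg_cong[OF F(2), of verts] arg_cong[OF F(2), of arcs] by simp_all
  have ends: "iso_tail F = fst" "iso_head F = snd"
    using arg_cong[OF F(2), of tail] arg_cong[OF F(2), of head] by simp_all
  have "iso_arcs F a = map_prod ?f ?f a" if "a \<in> parcs G" for a
    using F(1) that ends by (auto simp: digraph_isomorphism_def prod_eq_iff)
  then have arcs': "parcs H = map_prod ?f ?f ` parcs G" unfolding arcs by (rule image_cong[OF refl])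
  have wf: "u \<in> pverts G \<and> v \<in> pverts G" if "(u, v) \<in> parcs G" for u v
    using that in_arcsD1 in_arcsD2 by auto
  have "(u, v) \<in> parcs G \<longleftrightarrow> c (?f u) \<noteq> c (?f v)" if "u \<in> pverts G" "v \<in> pverts G" for u v
  proof -
    have "(u, v) \<in> parcs G \<longleftrightarrow> (?f u, ?f v) \<in> parcs H"
    proof
      assume "(?f u, ?f v) \<in> parcs H"
      then obtain u' v' where a: "(u', v') \<in> parcs G" "?f u = ?f u'" "?f v = ?f v'"
        unfolding arcs' by auto
      with wf[OF a(1)] that inj have "u = u'" "v = v'" by (auto dest: inj_onD)
      with a(1) show "(u, v) \<in> parcs G" by simp
    qed (force simp: arcs')
    also have "\<dots> \<longleftrightarrow> c (?f u) \<noteq> c (?f v)"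
      using H that img by (auto simp: complete_multipartite_def)
    finally show ?thesis .
  qed
  with wf have "complete_multipartite G (\<lambda>v. c (?f v))"
    unfolding complete_multipartite_def by (intro equalityI subrelI) blast+
  moreover have "bij_betw ?f (pverts G) (pverts H)" using inj img by (simp add: bij_betw_def)
  ultimately show thesis using that by blast
qed

lemma gen_distance_mat_nonneg:
  assumes "pair_graph G" "0 \<le> \<alpha>" "\<alpha> \<le> 1" "i < card (pverts G)" "j < card (pverts G)"
  shows "0 \<le> gen_distance_mat \<alpha> G $$ (i, j)"
  unfolding gen_distance_mat_index[OF assms(4,5)] transmission_def
  using assms(2,3) vdist_nonneg[OF assms(1)]
  by (auto intro!: add_nonneg_nonneg mult_nonneg_nonneg sum_nonneg)

text \<open>\<open>LEAST\<close> is meaningful only if some colouring exists; an enumeration of the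
  vertices is one, since there are no loops.\<close>

lemma proper_coloring_chromatic_number:
  assumes "pair_graph G"
  obtains c where "proper_coloring G (chromatic_number G) c"
proof -
  interpret pair_graph G by fact
  obtain g where g: "bij_betw g (pverts G) {0..<card (pverts G)}"
    using ex_bij_betw_finite_nat[OF pair_finite_verts] by blast
  have "g u \<noteq> g v" if "(u, v) \<in> parcs G" for u v
  proof -
    have "u \<in> pverts G" "v \<in> pverts G" using that in_arcsD1 in_arcsD2 by auto
    moreover have "u \<noteq> v" using pair_no_loops[OF that] by simp
    ultimately show ?thesis using bij_betw_imp_inj_on[OF g] by (auto dest: inj_onD)
  qed
  then have "proper_coloring G (card (pverts G)) g"
    using bij_betwE[OF g] by (auto simp: proper_coloring_def)
  then have "\<exists>k c. proper_coloring G k c" by blast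
  from LeastI_ex[OF this] that show thesis unfolding chromatic_number_def by blast
qed

section \<open>The radius of balanced graphs, the strict bound otherwise, and isomorphism with the
  Turan graph\<close>

context turan_parameters
begin

text \<open>The vector with value \<open>1 / (t - m k)\<close> on part \<open>k\<close> is a
  positive eigenvector for \<open>rad\<close>.\<close>

lemma gen_distance_radius_balanced:
  assumes G: "pair_graph G" "card (pverts G) = n" and multi: "complete_multipartite G c"
    and c: "\<And>v. v \<in> pverts G \<Longrightarrow> c v < r"
    and balanced: "\<And>k. k < r \<Longrightarrow> card {v \<in> pverts G. c v = k} \<in> {d, d + 1}"
  shows "gen_distance_radius \<alpha> G = rad"
proof -
  interpret pair_graph G by fact
  define m where "m k = card {v \<in> pverts G. c v = k}" for k
  define x where "x k = 1 / (t - m k)" for k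
  have m: "m k \<in> {d, d + 1}" if "k < r" for k using balanced[OF that] by (simp add: m_def)
  have sum: "(\<Sum>k<r. m k) = n" unfolding m_def using sum_card_fibres[of "pverts G" c r] c G(2) by simp
  \<comment> \<open>Since \<open>d\<close> is positive no part is empty; parts 0 and 1 then supply
    the two differently labelled vertices needed for the distance formula.\<close>
  have "\<exists>a\<in>pverts G. c a = k" if "k < r" for k
  proof (rule ccontr)
    assume "\<not> ?thesis"
    then have "m k = 0" by (auto simp: m_def)
    then show False using m[OF that] d_pos by auto
  qed
  from this[of 0] this[of 1] r obtain a b where ab: "a \<in> pverts G" "b \<in> pverts G" "c a \<noteq> c b"
    by force
  have xt: "0 < x k" "(t - m k) * x k = 1" if "k < r" for k
    using chord_eq(2)[OF m[OF that]] by (auto simp: x_def)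
  let ?x = "vec n (\<lambda>j. x (c (vertex_list G ! j)))"
  have vl: "vertex_list G ! i \<in> pverts G" if "i < n" for i
    using vertex_list_nth(2)[OF G(1)] that G(2) by (auto simp: bij_betw_def)
  have eig: "gen_distance_op \<alpha> (pverts G) (vdist G) (\<lambda>v. x (c v)) u = rad * x (c u)"
    if u: "u \<in> pverts G" for u
  proof -
    have "gen_distance_op \<alpha> (pverts G) (vdist G) (\<lambda>v. x (c v)) u =
      gen_distance_op \<alpha> (pverts G) (multipartite_dist c) (\<lambda>v. x (c v)) u"
      unfolding gen_distance_op_def
      using vdist_complete_multipartite[OF G(1) multi ab u] by (intro sum.cong) auto
    also have "\<dots> = (\<alpha> * n + m (c u) - 2) * x (c u) + (1 - \<alpha>) * (\<Sum>k<r. m k * x k)"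
      using gen_distance_op_multipartite[where V = "pverts G" and c = c and r = r and x = x and \<alpha> = \<alpha>, OF _ c u]
        G(2) by (simp add: m_def)
    also have "(1 - \<alpha>) * (\<Sum>k<r. m k * x k) = (t - m (c u)) * x (c u)"
      using balanced_weights[OF sum m] xt(2)[OF c[OF u]] by (simp add: x_def)
    finally show ?thesis by (simp add: rad_def algebra_simps)
  qed
  have "gen_distance_mat \<alpha> G *\<^sub>v ?x = rad \<cdot>\<^sub>v ?x"
  proof (rule eq_vecI)
    fix i assume "i < dim_vec (rad \<cdot>\<^sub>v ?x)"
    then have i: "i < n" by simp
    show "(gen_distance_mat \<alpha> G *\<^sub>v ?x) $ i = (rad \<cdot>\<^sub>v ?x) $ i"
      using gen_distance_mat_mult_vec[OF G(1), of i \<alpha> "\<lambda>v. x (c v)"] i eig[OF vl[OF i]]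
      by (simp add: G(2))
  qed (use gen_distance_mat_carrier[of \<alpha> G] G(2) in simp)
  then show ?thesis
    unfolding gen_distance_radius_def
    using gen_distance_mat_carrier[of \<alpha> G] gen_distance_mat_nonneg[OF G(1), of \<alpha>] \<alpha>(1) \<alpha>_less_1 G(2) n_gt
      xt(1) c vl
    by (intro spectral_radius_eq_positive_eigenvector[where x = ?x and n = n]) auto
qed

text \<open>Strictness has two sources: unbalanced parts make the weight inequalities strict, and
  for balanced parts a missing arc between two parts makes some distance strictly larger.\<close>

lemma gen_distance_radius_greater:
  assumes G: "pair_graph G" "Digraph_Component.connected (with_proj G)" "card (pverts G) = n"
    and c: "proper_coloring G r c"
    and not_turan: "\<not> (complete_multipartite G c \<and>
      (\<forall>k<r. card {v \<in> pverts G. c v = k} \<in> {d, d + 1}))"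
  shows "rad < gen_distance_radius \<alpha> G"
proof -
  interpret pair_graph G by fact
  define m where "m k = card {v \<in> pverts G. c v = k}" for k
  have cr: "c v < r" if "v \<in> pverts G" for v using c that by (simp add: proper_coloring_def)
  have sum: "(\<Sum>k<r. m k) = n" unfolding m_def using sum_card_fibres[of "pverts G" c r] cr G(3) by simp
  \<comment> \<open>One choice of weights for both cases; \<open>strict\<close> records which source
    of strictness is available.\<close>
  obtain x :: "nat \<Rightarrow> real" where x: "\<And>k. k < r \<Longrightarrow> 0 < x k"
    "\<And>k. k < r \<Longrightarrow> (t - m k) * x k \<le> (1 - \<alpha>) * (\<Sum>j<r. m j * x j)"
    and strict: "(\<forall>k<r. (t - m k) * x k < (1 - \<alpha>) * (\<Sum>j<r. m j * x j))
      \<or> (\<forall>k<r. m k \<in> {d, d + 1})"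
  proof (cases "\<forall>k<r. m k \<in> {d, d + 1}")
    case True
    define x where "x k = 1 / (t - m k)" for k
    have "0 < x k" "(t - m k) * x k = 1" if "k < r" for k
      using chord_eq(2)[of "m k"] True that by (simp_all add: x_def)
    moreover have "(1 - \<alpha>) * (\<Sum>j<r. m j * x j) = 1"
      using balanced_weights[OF sum] True unfolding x_def by blast
    ultimately show thesis using that[of x] True by simp
  next
    case False
    then obtain k0 where "k0 < r" "m k0 \<notin> {d, d + 1}" by blast
    from unbalanced_weights[OF sum this] obtain x :: "nat \<Rightarrow> real" where
      "\<And>k. k < r \<Longrightarrow> 0 < x k"
      "\<And>k. k < r \<Longrightarrow> (t - m k) * x k < (1 - \<alpha>) * (\<Sum>j<r. m j * x j)"
      by blast
    then show thesis using that[of x] by (simp add: less_imp_le)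
  qed
  define h where "h = (\<lambda>v. x (c v))"
  have h: "0 < h v" if "v \<in> pverts G" for v using x(1) cr[OF that] by (simp add: h_def)
  have le: "multipartite_dist c u v \<le> vdist G u v" if "u \<in> pverts G" "v \<in> pverts G" for u v
    using multipartite_dist_le_vdist(1)[OF G(1,2) c that] .
  have wpos: "0 < \<alpha> * h u + (1 - \<alpha>) * h v" if "u \<in> pverts G" "v \<in> pverts G" for u v
    using \<alpha>(1) \<alpha>_less_1 h[OF that(1)] h[OF that(2)] by (simp add: add_nonneg_pos)
  let ?K = "gen_distance_op \<alpha> (pverts G) (multipartite_dist c) h"
  let ?D = "gen_distance_op \<alpha> (pverts G) (vdist G) h"
  \<comment> \<open>The excess over \<open>rad * h u\<close> is exactly the slack in the weight
    inequality for the part of \<open>u\<close>.\<close>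
  have K: "?K u = rad * h u + ((1 - \<alpha>) * (\<Sum>k<r. m k * x k) - (t - m (c u)) * x (c u))"
    if u: "u \<in> pverts G" for u
    using gen_distance_op_multipartite[where V = "pverts G" and c = c and r = r and x = x and \<alpha> = \<alpha>, OF _ cr u]
    by (simp add: G(3) m_def h_def rad_def algebra_simps)
  have KD: "?K u \<le> ?D u" if u: "u \<in> pverts G" for u
    unfolding gen_distance_op_def
    using le[OF u] wpos[OF u] by (intro sum_mono mult_right_mono) (auto simp: less_imp_le)
  have D: "rad * h u \<le> ?D u" if u: "u \<in> pverts G" for u
    using K[OF u] KD[OF u] x(2)[OF cr[OF u]] by linarith
  have "\<exists>u\<in>pverts G. rad * h u < ?D u"
  proof (cases "\<forall>k<r. m k \<in> {d, d + 1}")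
    case False
    obtain u where u: "u \<in> pverts G" using G(3) n_gt by fastforce
    have "rad * h u < ?K u" using K[OF u] strict False cr[OF u] by force
    then show ?thesis using KD[OF u] u by force
  next
    case True
    then have "\<not> complete_multipartite G c" using not_turan by (simp add: m_def)
    moreover have "u \<in> pverts G \<and> v \<in> pverts G \<and> c u \<noteq> c v" if "(u, v) \<in> parcs G" for u v
      using that c in_arcsD1 in_arcsD2 by (auto simp: proper_coloring_def)
    ultimately obtain u v where uv: "u \<in> pverts G" "v \<in> pverts G" "c u \<noteq> c v" "(u, v) \<notin> parcs G"
      unfolding complete_multipartite_def by auto
    have "?K u < ?D u"
      unfolding gen_distance_op_def
    proof (rule sum_strict_mono_ex1)
      show "\<exists>w\<in>pverts G. multipartite_dist c u w * (\<alpha> * h u + (1 - \<alpha>) * h w)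
          < vdist G u w * (\<alpha> * h u + (1 - \<alpha>) * h w)"
        using multipartite_dist_le_vdist(2)[OF G(1,2) c uv] wpos uv
        by (intro bexI[of _ v] mult_strict_right_mono) auto
    qed (use le[OF uv(1)] wpos[OF uv(1)] in \<open>auto intro: mult_right_mono simp: less_imp_le\<close>)
    then show ?thesis using K[OF uv(1)] x(2)[OF cr[OF uv(1)]] uv(1) by force
  qed
  then obtain u where u: "u \<in> pverts G" "rad * h u < ?D u" by blast
  have bij: "bij_betw (\<lambda>i. vertex_list G ! i) {..<n} (pverts G)"
    using vertex_list_nth(2)[OF G(1)] G(3) by simp
  then have "u \<in> (\<lambda>i. vertex_list G ! i) ` {..<n}" using u(1) by (simp add: bij_betw_def)
  then obtain i0 where i0: "i0 < n" "vertex_list G ! i0 = u" by auto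
  have vl: "vertex_list G ! i \<in> pverts G" if "i < n" for i
    using bij that by (auto simp: bij_betw_def)
  have off: "0 < gen_distance_mat \<alpha> G $$ (i, j)" if ij: "i < n" "j < n" "i \<noteq> j" for i j
  proof -
    have "vertex_list G ! i \<noteq> vertex_list G ! j"
      using bij_betw_imp_inj_on[OF bij] ij by (auto dest: inj_onD)
    then have "0 < multipartite_dist c (vertex_list G ! i) (vertex_list G ! j)"
      by (simp add: multipartite_dist_def)
    then have "0 < vdist G (vertex_list G ! i) (vertex_list G ! j)"
      using le[OF vl[OF ij(1)] vl[OF ij(2)]] by linarith
    then show ?thesis using ij G(3) \<alpha>_less_1 by (simp add: gen_distance_mat_index)
  qed
  let ?x = "vec n (\<lambda>j. h (vertex_list G ! j))"
  have mult: "(gen_distance_mat \<alpha> G *\<^sub>v ?x) $ i = ?D (vertex_list G ! i)" if "i < n" for i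
    using gen_distance_mat_mult_vec[OF G(1), of i \<alpha> h] that G(3) by simp
  show ?thesis
    unfolding gen_distance_radius_def
  proof (rule spectral_radius_gt_subeigenvector[where x = ?x and n = n])
    show "gen_distance_mat \<alpha> G \<in> carrier_mat n n"
      using gen_distance_mat_carrier[of \<alpha> G] G(3) by simp
    show "0 \<le> gen_distance_mat \<alpha> G $$ (i, j)" if "i < n" "j < n" for i j
      using gen_distance_mat_nonneg[OF G(1)] \<alpha>(1) \<alpha>_less_1 G(3) that by simp
    show "rad * ?x $ i \<le> (gen_distance_mat \<alpha> G *\<^sub>v ?x) $ i" if "i < n" for i
      using D[OF vl[OF that]] that mult[OF that] by simp
    show "rad * ?x $ i0 < (gen_distance_mat \<alpha> G *\<^sub>v ?x) $ i0"
      using u(2) i0 mult[OF i0(1)] by simp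
  qed (use off i0(1) h vl in auto)
qed

lemma complete_multipartite_turan_graph: "complete_multipartite (turan_graph n r) (\<lambda>i. i mod r)"
  by (auto simp: complete_multipartite_def turan_graph_def)

lemma turan_parts:
  assumes "k < r"
  shows "card {i \<in> pverts (turan_graph n r). i mod r = k} \<in> {d, d + 1}"
proof -
  have "n div r = d" using n s by simp
  then show ?thesis using card_turan_part[OF assms, of n] by simp
qed

lemma card_verts_turan_graph: "card (pverts (turan_graph n r)) = n"
  by (simp add: turan_graph_def)

lemma gen_distance_radius_turan_graph: "gen_distance_radius \<alpha> (turan_graph n r) = rad"
  using gen_distance_radius_balanced[OF pair_graph_turan_graph card_verts_turan_graph
      complete_multipartite_turan_graph _ turan_parts] r by simp

text \<open>A permutation \<open>p\<close> of the labels first matches parts of equal size; a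
  bijection of vertices respecting \<open>p\<close> is then an isomorphism.\<close>

lemma digraph_iso_turan_graph:
  assumes G: "pair_graph G" "card (pverts G) = n" and multi: "complete_multipartite G c"
    and c: "\<And>v. v \<in> pverts G \<Longrightarrow> c v < r"
    and balanced: "\<And>k. k < r \<Longrightarrow> card {v \<in> pverts G. c v = k} \<in> {d, d + 1}"
  shows "digraph_iso (with_proj G) (with_proj (turan_graph n r))"
proof -
  interpret pair_graph G by fact
  let ?T = "pverts (turan_graph n r)"
  define m where "m k = card {v \<in> pverts G. c v = k}" for k
  define m' where "m' k = card {i \<in> ?T. i mod r = k}" for k
  have finT: "finite ?T" by (simp add: turan_graph_def)
  have cT: "i mod r < r" for i using r by simp
  have sums: "(\<Sum>k<r. m k) = n" "(\<Sum>k<r. m' k) = n"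
    unfolding m_def m'_def
    using sum_card_fibres[of "pverts G" c r] c G(2) sum_card_fibres[OF finT cT] card_verts_turan_graph
    by simp_all
  have "card {k \<in> {..<r}. m k = e} = card {k \<in> {..<r}. m' k = e}" for e
    using card_parts_of_size[OF sums(1)] card_parts_of_size[OF sums(2)] balanced turan_parts
    unfolding m_def m'_def by presburger
  from fibrewise_bijection[OF finite_lessThan finite_lessThan this]
  obtain p where p: "bij_betw p {..<r} {..<r}" "\<And>k. k < r \<Longrightarrow> m' (p k) = m k" by auto
  have "card {v \<in> pverts G. p (c v) = k} = card {i \<in> ?T. i mod r = k}" for k
  proof (cases "k < r")
    case True
    then have "k \<in> p ` {..<r}" using p(1) by (simp add: bij_betw_def)
    then obtain k' where k': "k' < r" "p k' = k" by auto
    have "{v \<in> pverts G. p (c v) = k} = {v \<in> pverts G. c v = k'}"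
      using c k' bij_betw_imp_inj_on[OF p(1)] by (auto simp: inj_on_def)
    then show ?thesis using p(2)[OF k'(1)] k'(2) by (simp add: m_def m'_def)
  next
    \<comment> \<open>Fibres must agree for every label, so labels from \<open>r\<close> on are
      checked too: both sides are empty.\<close>
    case False
    have "p (c v) < r" if "v \<in> pverts G" for v using bij_betwE[OF p(1)] c[OF that] by auto
    then have "{v \<in> pverts G. p (c v) = k} = {}" "{i \<in> ?T. i mod r = k} = {}"
      using False cT by auto
    then show ?thesis by (simp only: card.empty)
  qed
  from fibrewise_bijection[OF pair_finite_verts finT this]
  obtain f where f: "bij_betw f (pverts G) ?T" "\<And>v. v \<in> pverts G \<Longrightarrow> f v mod r = p (c v)" by auto
  show ?thesis
  proof (rule digraph_iso_complete_multipartite[OF G(1) multi complete_multipartite_turan_graph f(1)])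
    fix u v assume uv: "u \<in> pverts G" "v \<in> pverts G"
    then show "f u mod r = f v mod r \<longleftrightarrow> c u = c v"
      using f(2) c bij_betw_imp_inj_on[OF p(1)] by (auto dest: inj_onD)
  qed
qed

text \<open>Residue classes pull back along the isomorphism to parts of \<open>G\<close> of the same
  sizes, so the balanced case applies directly, without conjugating matrices.\<close>

lemma gen_distance_radius_iso_turan_graph:
  assumes G: "pair_graph G" "card (pverts G) = n"
    and iso: "digraph_iso (with_proj G) (with_proj (turan_graph n r))"
  shows "gen_distance_radius \<alpha> G = rad"
proof -
  obtain f where f: "bij_betw f (pverts G) (pverts (turan_graph n r))"
    "complete_multipartite G (\<lambda>v. f v mod r)"
    using digraph_iso_complete_multipartite_pullback[OF iso G(1) complete_multipartite_turan_graph] .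
  show ?thesis
  proof (rule gen_distance_radius_balanced[OF G f(2)])
    show "f v mod r < r" for v using r by simp
    fix k assume k: "k < r"
    have "f ` {v \<in> pverts G. f v mod r = k} = {i \<in> pverts (turan_graph n r). i mod r = k}"
      using f(1) by (auto simp: bij_betw_def)
    moreover have "inj_on f {v \<in> pverts G. f v mod r = k}"
      using bij_betw_imp_inj_on[OF f(1)] by (rule inj_on_subset) auto
    ultimately have "card {v \<in> pverts G. f v mod r = k} =
        card {i \<in> pverts (turan_graph n r). i mod r = k}"
      using card_image by fastforce
    then show "card {v \<in> pverts G. f v mod r = k} \<in> {d, d + 1}"
      using turan_parts[OF k] by (simp only:)
  qed
qed

end

theorem theorem2p4:
  fixes G :: "'a pair_pre_digraph" and n r d s :: nat and \<alpha> :: real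
  assumes "pair_graph G"
    and "Digraph_Component.connected (with_proj G)"
    and "card (pverts G) = n"
    and "chromatic_number G = r"
    and "3 \<le> r" and "r \<le> n - 1"
    and "n = r * d + s" and "s < r"
    and "0 \<le> \<alpha>" and "\<alpha> \<le> 1 - 1 / real r"
  shows "gen_distance_radius \<alpha> G \<ge> gen_distance_radius \<alpha> (turan_graph n r)
    \<and> gen_distance_radius \<alpha> (turan_graph n r) =
        (real n + 2 * real d + \<alpha> * real n - 3
          + sqrt ((real n * (1 - \<alpha>) - 1)\<^sup>2 + 4 * real s * (1 - \<alpha>) * (real d + 1))) / 2
    \<and> (gen_distance_radius \<alpha> G = gen_distance_radius \<alpha> (turan_graph n r)
        \<longleftrightarrow> digraph_iso (with_proj G) (with_proj (turan_graph n r)))"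
proof -
  \<comment> \<open>The subtraction \<open>n - 1\<close> is truncated; \<open>3 \<le> r\<close>
    excludes \<open>n = 0\<close>.\<close>
  have "r < n" using assms(5,6) by linarith
  then interpret T: turan_parameters n r d s \<alpha>
    using assms(5,7-10) by unfold_locales
  obtain c where c: "proper_coloring G r c"
    using proper_coloring_chromatic_number[OF assms(1)] assms(4) by blast
  then have cr: "\<And>v. v \<in> pverts G \<Longrightarrow> c v < r" by (simp add: proper_coloring_def)
  \<comment> \<open>The dichotomy that settles everything: if \<open>?turan\<close> holds,
    \<open>G\<close> is isomorphic to the Turan graph and the radii agree; if it fails, the
    inequality is strict, which also rules out an isomorphism.\<close>
  let ?turan = "complete_multipartite G c \<and> (\<forall>k<r. card {v \<in> pverts G. c v = k} \<in> {d, d + 1})"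
  have "?turan \<Longrightarrow> digraph_iso (with_proj G) (with_proj (turan_graph n r))"
    using T.digraph_iso_turan_graph[OF assms(1,3), of c] cr by blast
  moreover have "digraph_iso (with_proj G) (with_proj (turan_graph n r)) \<Longrightarrow>
      gen_distance_radius \<alpha> G = T.rad"
    by (rule T.gen_distance_radius_iso_turan_graph[OF assms(1,3)])
  moreover have "\<not> ?turan \<Longrightarrow> T.rad < gen_distance_radius \<alpha> G"
    by (rule T.gen_distance_radius_greater[OF assms(1,2,3) c])
  moreover have "T.rad = (real n + 2 * real d + \<alpha> * real n - 3
      + sqrt ((real n * (1 - \<alpha>) - 1)\<^sup>2 + 4 * real s * (1 - \<alpha>) * (real d + 1))) / 2"
    by (simp add: T.rad_def T.t_def T.y_def field_simps)
  ultimately show ?thesis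
    unfolding T.gen_distance_radius_turan_graph by (smt (verit))
qed

end
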